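(* Let $n\ge 1$ be an integer. For $i=1,\dots,n-1$ the Gauss--Legendre polynomial $F^n_i$ has the following representation in the Legendre basis: $$F^n_i(t)=\frac{1}{2}\left(P_{n-1}(\tau_i)-P_{n-1}(\tau_{i+1})\right)P_n(t)+\frac{1}{2}\sum_{k=0}^{n-1}\left(R_{k}(\tau_{i+1})-R_{k}(\tau_i)\right)P_k(t).$$ Moreover, $$F^n_0(t)=\frac{1}{2}-\frac{1}{2}P_{n-1}(\tau_1)P_n(t)+\frac{1}{2}\sum_{k=0}^{n-1}R_{k}(\tau_1)P_k(t),$$ $$F^n_n(t)=\frac{1}{2}+\frac{1}{2}P_{n-1}(\tau_n)P_n(t)-\frac{1}{2}\sum_{k=0}^{n-1}R_{k}(\tau_n)P_k(t).$$ (All identities are identities of polynomials in $t$.)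
   Context: $P_k$ denotes the $k$th Legendre polynomial, normalized by $P_k(1)=1$, with the convention $P_{-1}\equiv0$. Define $R_k(t):=P_{k+1}(t)-P_{k-1}(t)$ for $k=0,1,\dots$ (so $R_0=P_1$). For the fixed integer $n\ge1$, $-1<\tau_1<\tau_2<\cdots<\tau_n<1$ are the zeros of $P_n$. Gauss--Legendre polynomials: set $G^n_0(t)\equiv\frac12$, $G^n_{n+1}(t)\equiv-\frac12$, and for $i=1,\dots,n$ $$G^n_i(t):=\frac{nP_{n-1}(\tau_i)}{2}\int_{-1}^{t}\frac{P_n(x)}{x-\tau_i}\,dx-\frac12 ,$$ where $P_n(x)/(x-\tau_i)$ is regarded as a polynomial. Then $F^n_i(t):=G^n_i(t)-G^n_{i+1}(t)$ for $i=0,1,\dots,n$. *)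

theory Defs
  imports "HOL-Analysis.Interval_Integral" "HOL-Computational_Algebra.Polynomial"
begin

text \<open>The Legendre polynomials, by Bonnet's recursion
  \<open>(k+2) P_{k+2}(t) = (2k+3) t P_{k+1}(t) - (k+1) P_k(t)\<close>.\<close>

fun legendre_poly :: "nat \<Rightarrow> real poly" where
  "legendre_poly 0 = 1"
| "legendre_poly (Suc 0) = [:0, 1:]"
| "legendre_poly (Suc (Suc k)) =
     smult (1 / real (k + 2))
       (smult (real (2 * k + 3)) ([:0, 1:] * legendre_poly (Suc k))
        - smult (real (k + 1)) (legendre_poly k))"

abbreviation legendre :: "nat \<Rightarrow> real \<Rightarrow> real" where
  "legendre k t \<equiv> poly (legendre_poly k) t"

lemma legendre_normalized: "legendre k 1 = 1"
  by (induction k rule: legendre_poly.induct) (simp_all add: field_simps)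

text \<open>The case distinction is the convention \<open>P_{-1} = 0\<close>.\<close>

definition R :: "nat \<Rightarrow> real \<Rightarrow> real" where
  "R k t = legendre (k + 1) t - (if k = 0 then 0 else legendre (k - 1) t)"

text \<open>The zeros \<open>\<tau> 1 < \<dots> < \<tau> n\<close> of \<open>P_n\<close> are a parameter. The integral is the oriented one,
  so that the formula is also correct for \<open>t < -1\<close>; the integrand is the polynomial quotient of
  \<open>P_n\<close> by \<open>x - \<tau> i\<close>, an exact division when \<open>\<tau> i\<close> is a zero. Only indices \<open>i \<le> n + 1\<close>
  are meaningful.\<close>

definition G :: "nat \<Rightarrow> (nat \<Rightarrow> real) \<Rightarrow> nat \<Rightarrow> real \<Rightarrow> real" where
  "G n \<tau> i t =
     (if i = 0 then 1 / 2
      else if i = n + 1 then - 1 / 2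
      else real n * legendre (n - 1) (\<tau> i) / 2
             * (LBINT x=-1..t. poly (legendre_poly n div [:- \<tau> i, 1:]) x) - 1 / 2)"

definition F :: "nat \<Rightarrow> (nat \<Rightarrow> real) \<Rightarrow> nat \<Rightarrow> real \<Rightarrow> real" where
  "F n \<tau> i t = G n \<tau> i t - G n \<tau> (i + 1) t"

end

theory Submission imports Defs begin

text \<open>
  All three formulas are differences of one expansion: if \<open>\<tau> i\<close> is a zero of \<open>P_n\<close> then
  \<open>G_i(t) = P_{n-1}(\<tau> i) P_n(t) / 2 - (\<Sum>k<n. R_k(\<tau> i) P_k(t)) / 2\<close>; the end cases arise because
  \<open>G_0\<close> and \<open>G_{n+1}\<close> are the constants \<open>1/2\<close> and \<open>-1/2\<close>.

  To obtain this expansion, set \<open>y = \<tau> i\<close>. Since \<open>P_n(y) = 0\<close>, the Christoffel--Darboux formula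
  collapses to \<open>n P_{n-1}(y) P_n(x) / (x - y) = (\<Sum>k<n. (2k+1) P_k(y) P_k(x))\<close>, so the integrand in
  the definition of \<open>G_i\<close> is expanded in Legendre polynomials. Each term integrates in
  closed form because \<open>R_k' = (2k+1) P_k\<close>. At the lower limit \<open>-1\<close> every \<open>R_k\<close> vanishes except
  \<open>R_0(-1) = -1\<close>, and the resulting constant cancels the \<open>-1/2\<close> in the definition of \<open>G_i\<close>. This
  leaves \<open>G_i(t) = (\<Sum>k<n. P_k(y) R_k(t)) / 2\<close>. Finally, summation by parts moves the difference
  operator \<open>R\<close> from \<open>t\<close> to \<open>y\<close>; of its boundary terms \<open>P_{n-1}(y) P_n(t)\<close> and \<open>P_n(y) P_{n-1}(t)\<close>
  only the first survives.
\<close>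

lemma legendre_bonnet:
  "real (k + 2) * legendre (k + 2) x
     = real (2 * k + 3) * x * legendre (k + 1) x - real (k + 1) * legendre k x"
  by (simp add: field_simps)

lemma legendre_at_minus_one: "legendre k (- 1) = (- 1) ^ k"
  by (induction k rule: legendre_poly.induct) (simp_all add: field_simps)

lemma pderiv_legendre_bonnet:
  "real (k + 2) * poly (pderiv (legendre_poly (k + 2))) x
     = real (2 * k + 3) * (legendre (k + 1) x + x * poly (pderiv (legendre_poly (k + 1))) x)
       - real (k + 1) * poly (pderiv (legendre_poly k)) x"
  by (simp add: pderiv_smult pderiv_diff pderiv_mult pderiv_pCons field_simps)

text \<open>
  The two first-order recurrences have to be proved together. The second one at \<open>k + 1\<close> is
  Bonnet's recursion differentiated, with \<open>P_k'\<close> eliminated by the first one at \<open>k\<close>; the first one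
  at \<open>k + 1\<close> then needs both at \<open>k\<close>, which combine to
  \<open>(x\<^sup>2 - 1) P_{k+1}' = (k+1) (x P_{k+1} - P_k)\<close>.
\<close>

lemma legendre_derivative_recurrences:
  fixes x :: real
  defines "D \<equiv> \<lambda>k. poly (pderiv (legendre_poly k)) x"
  shows "x * D (Suc k) - D k = real (Suc k) * legendre (Suc k) x
       \<and> D (Suc k) - x * D k = real (Suc k) * legendre k x"
proof (induction k)
  case 0
  show ?case by (simp add: D_def pderiv_pCons)
next
  case (Suc k)
  let ?K = "real k"
  have lower: "x * D (Suc k) - D k = (?K + 1) * legendre (Suc k) x"
    and upper: "D (Suc k) - x * D k = (?K + 1) * legendre k x"
    using Suc.IH by (auto simp add: algebra_simps)
  have bonnet: "(?K + 2) * legendre (Suc (Suc k)) x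
      = (2 * ?K + 3) * x * legendre (Suc k) x - (?K + 1) * legendre k x"
    using legendre_bonnet[of k x] by (simp del: legendre_poly.simps add: algebra_simps)
  have bonnet': "(?K + 2) * D (Suc (Suc k))
      = (2 * ?K + 3) * (legendre (Suc k) x + x * D (Suc k)) - (?K + 1) * D k"
    using pderiv_legendre_bonnet[of k x]
    by (simp del: legendre_poly.simps add: D_def algebra_simps)
  have "(?K + 2) * D (Suc (Suc k)) = (?K + 2) * (x * D (Suc k) + (?K + 2) * legendre (Suc k) x)"
    using bonnet' lower by algebra
  then have upper': "D (Suc (Suc k)) = x * D (Suc k) + (?K + 2) * legendre (Suc k) x"
    by simp
  have lower': "x * D (Suc (Suc k)) - D (Suc k) = (?K + 2) * legendre (Suc (Suc k)) x"
    using upper' bonnet lower upper by algebra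
  show ?case
    using upper' lower' by (simp del: legendre_poly.simps add: algebra_simps)
qed

text \<open>For \<open>k > 0\<close> this is the first recurrence at \<open>k - 1\<close> added to the second at \<open>k\<close>; it makes \<open>R k\<close> a primitive of
  \<open>(2k+1) P_k\<close>, which is what allows the kernel to be integrated term by term.\<close>

lemma DERIV_R: "((\<lambda>x. R k x) has_real_derivative real (2 * k + 1) * legendre k x) (at x within S)"
proof (cases k)
  case 0
  have "((\<lambda>x. x) has_real_derivative 1) (at x within S)" by simp
  then show ?thesis by (simp add: 0 R_def[abs_def])
next
  case (Suc j)
  have "((\<lambda>x. R k x) has_real_derivative
      poly (pderiv (legendre_poly (Suc (Suc j)))) x - poly (pderiv (legendre_poly j)) x)
      (at x within S)"
    unfolding R_def Suc
    by (auto simp del: legendre_poly.simps intro!: DERIV_diff DERIV_subset[OF poly_DERIV])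
  moreover have "poly (pderiv (legendre_poly (Suc (Suc j)))) x - poly (pderiv (legendre_poly j)) x
      = real (2 * k + 1) * legendre k x"
    using legendre_derivative_recurrences[where k = j and x = x, THEN conjunct1]
      legendre_derivative_recurrences[where k = "Suc j" and x = x, THEN conjunct2]
    by (simp del: legendre_poly.simps add: Suc distrib_right)
  ultimately show ?thesis by simp
qed

lemma R_at_minus_one: "R k (- 1) = (if k = 0 then - 1 else 0)"
  by (cases k) (simp_all del: legendre_poly.simps(3) add: R_def legendre_at_minus_one)

text \<open>
  Christoffel--Darboux: multiplying the kernel by \<open>x - y\<close> and applying Bonnet's recursion to
  \<open>x P_k(x)\<close> and \<open>y P_k(y)\<close> makes the sum telescope.
\<close>

lemma christoffel_darboux:
  "(x - y) * (\<Sum>k\<le>m. real (2 * k + 1) * legendre k y * legendre k x)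
     = real (Suc m) * (legendre (Suc m) x * legendre m y - legendre m x * legendre (Suc m) y)"
proof (induction m)
  case 0
  show ?case by simp
next
  case (Suc m)
  let ?M = "real m"
  let ?S = "\<Sum>k\<le>m. real (2 * k + 1) * legendre k y * legendre k x"
  have bx: "(?M + 2) * legendre (Suc (Suc m)) x
      = (2 * ?M + 3) * x * legendre (Suc m) x - (?M + 1) * legendre m x"
    and by': "(?M + 2) * legendre (Suc (Suc m)) y
      = (2 * ?M + 3) * y * legendre (Suc m) y - (?M + 1) * legendre m y"
    using legendre_bonnet[of m x] legendre_bonnet[of m y]
    by (simp_all del: legendre_poly.simps add: algebra_simps)
  have "(x - y) * (?S + (2 * ?M + 3) * legendre (Suc m) y * legendre (Suc m) x)
      = (?M + 1) * (legendre (Suc m) x * legendre m y - legendre m x * legendre (Suc m) y)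
        + (x - y) * (2 * ?M + 3) * legendre (Suc m) y * legendre (Suc m) x"
    using Suc.IH by (simp del: legendre_poly.simps add: algebra_simps)
  also have "\<dots> = (?M + 2) * legendre (Suc (Suc m)) x * legendre (Suc m) y
        - legendre (Suc m) x * ((?M + 2) * legendre (Suc (Suc m)) y)"
    unfolding bx by' by (simp del: legendre_poly.simps add: algebra_simps)
  finally show ?case
    by (simp del: legendre_poly.simps add: algebra_simps)
qed

text \<open>
  The identity is proved for polynomials, cancelling the factor \<open>x - y\<close>, so that it also holds
  at \<open>x = y\<close>, where the pointwise Christoffel--Darboux formula gives nothing.
\<close>

lemma legendre_quotient_expansion:
  assumes "legendre (Suc m) y = 0"
  shows "real (Suc m) * legendre m y * poly (legendre_poly (Suc m) div [:- y, 1:]) x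
     = (\<Sum>k\<le>m. real (2 * k + 1) * legendre k y * legendre k x)"
proof -
  define K where "K = (\<Sum>k\<le>m. smult (real (2 * k + 1) * legendre k y) (legendre_poly k))"
  define Q where "Q = legendre_poly (Suc m) div [:- y, 1:]"
  have factor: "[:- y, 1:] * Q = legendre_poly (Suc m)"
    using assms unfolding Q_def
    by (intro dvd_mult_div_cancel) (simp only: poly_eq_0_iff_dvd)
  have "[:- y, 1:] * K = smult (real (Suc m) * legendre m y) (legendre_poly (Suc m))"
  proof (rule poly_eq_poly_eq_iff[THEN iffD1], rule ext)
    fix z
    show "poly ([:- y, 1:] * K) z
        = poly (smult (real (Suc m) * legendre m y) (legendre_poly (Suc m))) z"
      using christoffel_darboux[of z y m] assms
      by (simp del: legendre_poly.simps add: K_def poly_sum algebra_simps)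
  qed
  also have "\<dots> = [:- y, 1:] * smult (real (Suc m) * legendre m y) Q"
    by (simp only: factor[symmetric] mult_smult_right)
  finally have "K = smult (real (Suc m) * legendre m y) Q"
    by (subst (asm) mult_cancel_left) auto
  then have "poly K x = real (Suc m) * legendre m y * poly Q x" by simp
  then show ?thesis by (simp add: K_def Q_def poly_sum)
qed

lemma legendre_R_summation_by_parts:
  "(\<Sum>k\<le>m. legendre k y * R k t) + (\<Sum>k\<le>m. R k y * legendre k t)
     = legendre m y * legendre (Suc m) t + legendre (Suc m) y * legendre m t"
  by (induction m) (simp_all del: legendre_poly.simps(3) add: R_def algebra_simps)

text \<open>The quotient in the integrand, scaled by \<open>n P_{n-1}(\<tau> i)\<close>, is the derivative of
  \<open>\<Sum>k<n. P_k(\<tau> i) R_k\<close>. This primitive takes the value \<open>-1\<close> at \<open>-1\<close>, which is why \<open>G\<close> subtracts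
  \<open>1/2\<close>.\<close>

lemma G_eq_sum_R:
  assumes "1 \<le> i" "i \<le> Suc m" and root: "legendre (Suc m) (\<tau> i) = 0"
  shows "G (Suc m) \<tau> i t = 1 / 2 * (\<Sum>k\<le>m. legendre k (\<tau> i) * R k t)"
proof -
  let ?y = "\<tau> i"
  let ?c = "real (Suc m) * legendre m ?y"
  let ?Q = "legendre_poly (Suc m) div [:- ?y, 1:]"
  let ?\<Phi> = "\<lambda>x. \<Sum>k\<le>m. legendre k ?y * R k x"
  have deriv: "(?\<Phi> has_real_derivative ?c * poly ?Q x) (at x within S)" for x S
    unfolding legendre_quotient_expansion[OF root]
    by (auto intro!: derivative_eq_intros DERIV_R sum.cong)
  have "?c * (LBINT x=-1..t. poly ?Q x) = (LBINT x=-1..t. ?c * poly ?Q x)"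
    by simp
  also have "\<dots> = (LBINT x=ereal (- 1)..ereal t. ?c * poly ?Q x)"
    by (simp add: one_ereal_def)
  also have "\<dots> = ?\<Phi> t - ?\<Phi> (- 1)"
  proof (rule interval_integral_FTC_finite)
    show "continuous_on {min (- 1) t..max (- 1) t} (\<lambda>x. ?c * poly ?Q x)"
      by (intro continuous_intros)
  qed (rule deriv[unfolded has_real_derivative_iff_has_vector_derivative])
  also have "?\<Phi> (- 1) = - 1"
    by (simp add: R_at_minus_one if_distrib cong: if_cong)
  finally have "?c * (LBINT x=-1..t. poly ?Q x) = ?\<Phi> t + 1" by simp
  then show ?thesis
    using assms(1,2) by (simp del: legendre_poly.simps add: G_def field_simps)
qed

theorem G_legendre_expansion:
  assumes "1 \<le> i" "i \<le> n" and root: "legendre n (\<tau> i) = 0"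
  shows "G n \<tau> i t = 1 / 2 * legendre (n - 1) (\<tau> i) * legendre n t
     - 1 / 2 * (\<Sum>k=0..n-1. R k (\<tau> i) * legendre k t)"
proof -
  obtain m where n: "n = Suc m"
    using assms(1,2) by (cases n) auto
  show ?thesis
    using G_eq_sum_R[of i m \<tau> t] legendre_R_summation_by_parts[of "\<tau> i" t m] assms
    by (simp del: legendre_poly.simps add: n atLeast0AtMost)
qed

theorem theorem4p6:
  fixes n :: nat and \<tau> :: "nat \<Rightarrow> real"
  assumes "n \<ge> 1"
    and "strict_mono_on {1..n} \<tau>"
    and "-1 < \<tau> 1" and "\<tau> n < 1"
    and "{x. legendre n x = 0} = \<tau> ` {1..n}"
  shows "(\<forall>i\<in>{1..n-1}. \<forall>t.
            F n \<tau> i t = 1 / 2 * (legendre (n - 1) (\<tau> i) - legendre (n - 1) (\<tau> (i + 1))) * legendre n t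
              + 1 / 2 * (\<Sum>k=0..n-1. (R k (\<tau> (i + 1)) - R k (\<tau> i)) * legendre k t))
       \<and> (\<forall>t. F n \<tau> 0 t = 1 / 2 - 1 / 2 * legendre (n - 1) (\<tau> 1) * legendre n t
              + 1 / 2 * (\<Sum>k=0..n-1. R k (\<tau> 1) * legendre k t))
       \<and> (\<forall>t. F n \<tau> n t = 1 / 2 + 1 / 2 * legendre (n - 1) (\<tau> n) * legendre n t
              - 1 / 2 * (\<Sum>k=0..n-1. R k (\<tau> n) * legendre k t))"
proof -
  have expansion: "G n \<tau> i t = 1 / 2 * legendre (n - 1) (\<tau> i) * legendre n t
      - 1 / 2 * (\<Sum>k=0..n-1. R k (\<tau> i) * legendre k t)" if "1 \<le> i" "i \<le> n" for i t
  proof (rule G_legendre_expansion[OF that])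
    show "legendre n (\<tau> i) = 0" using assms(5) that by auto
  qed
  show ?thesis
  proof (intro conjI ballI allI)
    fix i t assume "i \<in> {1..n-1}"
    then have "1 \<le> i" "i \<le> n" "i + 1 \<le> n" by auto
    then show "F n \<tau> i t
        = 1 / 2 * (legendre (n - 1) (\<tau> i) - legendre (n - 1) (\<tau> (i + 1))) * legendre n t
          + 1 / 2 * (\<Sum>k=0..n-1. (R k (\<tau> (i + 1)) - R k (\<tau> i)) * legendre k t)"
      using expansion[of i t] expansion[of "i + 1" t]
      by (simp add: F_def left_diff_distrib right_diff_distrib sum_subtractf)
  next
    fix t
    have "G n \<tau> 0 t = 1 / 2" by (simp add: G_def)
    then show "F n \<tau> 0 t = 1 / 2 - 1 / 2 * legendre (n - 1) (\<tau> 1) * legendre n t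
        + 1 / 2 * (\<Sum>k=0..n-1. R k (\<tau> 1) * legendre k t)"
      using expansion[of 1 t] assms(1) by (simp add: F_def)
  next
    fix t
    have "G n \<tau> (n + 1) t = - 1 / 2" by (simp add: G_def)
    then show "F n \<tau> n t = 1 / 2 + 1 / 2 * legendre (n - 1) (\<tau> n) * legendre n t
        - 1 / 2 * (\<Sum>k=0..n-1. R k (\<tau> n) * legendre k t)"
      using expansion[of n t] assms(1) by (simp add: F_def)
  qed
qed

end
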